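(* Let $F=(f_I,f_3)$ be an orientation-preserving $\mathcal C^2$ contact diffeomorphism of $\mathfrak H^\star$, with $F^*\omega^\star=\lambda^\star\omega^\star$. Then $\lambda^\star$ is constant if and only if $F$ is circles-preserving.
   Context: The hyperbolic Heisenberg group $\mathfrak H^\star$ is $\mathbb C_*\times\mathbb R$, $\mathbb C_*=\mathbb C\setminus\{0\}$, with contact form $\omega^\star=\frac{dt+2\Im(\overline z\,dz)}{2|z|^2}$. An orientation-preserving contact diffeomorphism of $\mathfrak H^\star$ is an orientation-preserving diffeomorphism $F:\mathfrak H^\star\to\mathfrak H^\star$ with $F^*\omega^\star=\lambda^\star\omega^\star$ for some positive function $\lambda^\star$. Let $\mathcal L=\{\zeta\in\mathbb C:\Re(\zeta)<0\}$ and let $\alpha:\mathfrak H^\star\to\mathcal L$, $\alpha(z,t)=-|z|^2+it$, be the Korányi map. A bijection $F:\mathfrak H^\star\to\mathfrak H^\star$ is circles-preserving if for every $\zeta\in\mathcal L$ there exists $\eta\in\mathcal L$ with $F(\alpha^{-1}(\zeta))=\alpha^{-1}(\eta)$. *)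

theory Defs
  imports "HOL-Analysis.Analysis"
begin

definition C1_on :: "'a::real_normed_vector set \<Rightarrow> ('a \<Rightarrow> 'b::real_normed_vector) \<Rightarrow> bool" where
  "C1_on S f \<longleftrightarrow> (\<exists>f' :: 'a \<Rightarrow> 'a \<Rightarrow>\<^sub>L 'b.
     (\<forall>x\<in>S. (f has_derivative blinfun_apply (f' x)) (at x)) \<and> continuous_on S f')"

definition C2_on :: "'a::real_normed_vector set \<Rightarrow> ('a \<Rightarrow> 'b::real_normed_vector) \<Rightarrow> bool" where
  "C2_on S f \<longleftrightarrow> (\<exists>f' :: 'a \<Rightarrow> 'a \<Rightarrow>\<^sub>L 'b.
     (\<forall>x\<in>S. (f has_derivative blinfun_apply (f' x)) (at x)) \<and> C1_on S f')"

text \<open>Maps of the hyperbolic Heisenberg group are total functions on \<open>complex \<times> real\<close>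
  of which only the values on the following open set matter.\<close>

definition heis_star :: "(complex \<times> real) set" where
  "heis_star = (UNIV - {0}) \<times> UNIV"

text \<open>A 1-form assigns to a point \<open>p\<close> and a tangent vector \<open>v\<close> a number. A tangent vector
  \<open>(w, s)\<close> at \<open>(z, t)\<close> has \<open>dz (w, s) = w\<close> and \<open>dt (w, s) = s\<close>.\<close>

definition omega_star :: "complex \<times> real \<Rightarrow> complex \<times> real \<Rightarrow> real" where
  "omega_star = (\<lambda>(z, t) (w, s). (s + 2 * Im (cnj z * w)) / (2 * (cmod z)\<^sup>2))"

definition pullback_form ::
    "('a::real_normed_vector \<Rightarrow> 'b::real_normed_vector) \<Rightarrow> ('b \<Rightarrow> 'b \<Rightarrow> real) \<Rightarrow> 'a \<Rightarrow> 'a \<Rightarrow> real" where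
  "pullback_form F \<theta> = (\<lambda>p v. \<theta> (F p) (frechet_derivative F (at p) v))"

definition contact_factor ::
    "(complex \<times> real \<Rightarrow> complex \<times> real) \<Rightarrow> (complex \<times> real \<Rightarrow> real) \<Rightarrow> bool" where
  "contact_factor F lam \<longleftrightarrow>
     (\<forall>p\<in>heis_star. lam p > 0 \<and> (\<forall>v. pullback_form F omega_star p v = lam p * omega_star p v))"

definition C2_diffeo_on :: "'a::real_normed_vector set \<Rightarrow> ('a \<Rightarrow> 'a) \<Rightarrow> bool" where
  "C2_diffeo_on S F \<longleftrightarrow> bij_betw F S S \<and> C2_on S F \<and> C2_on S (inv_into S F)"

definition to_R3 :: "complex \<times> real \<Rightarrow> real ^ 3" where
  "to_R3 = (\<lambda>(z, t). vector [Re z, Im z, t])"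

definition of_R3 :: "real ^ 3 \<Rightarrow> complex \<times> real" where
  "of_R3 u = (Complex (u $ 1) (u $ 2), u $ 3)"

definition orientation_preserving :: "(complex \<times> real \<Rightarrow> complex \<times> real) \<Rightarrow> bool" where
  "orientation_preserving F \<longleftrightarrow>
     (\<forall>p\<in>heis_star. det (jacobian (to_R3 \<circ> F \<circ> of_R3) (at (to_R3 p))) > 0)"

definition op_C2_contact_diffeo :: "(complex \<times> real \<Rightarrow> complex \<times> real) \<Rightarrow> bool" where
  "op_C2_contact_diffeo F \<longleftrightarrow>
     C2_diffeo_on heis_star F \<and> orientation_preserving F \<and> (\<exists>lam. contact_factor F lam)"

definition left_half_plane :: "complex set" where
  "left_half_plane = {\<zeta>. Re \<zeta> < 0}"

definition koranyi_map :: "complex \<times> real \<Rightarrow> complex" where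
  "koranyi_map = (\<lambda>(z, t). - of_real ((cmod z)\<^sup>2) + \<i> * of_real t)"

definition koranyi_fibre :: "complex \<Rightarrow> (complex \<times> real) set" where
  "koranyi_fibre \<zeta> = koranyi_map -` {\<zeta>} \<inter> heis_star"

definition circles_preserving :: "(complex \<times> real \<Rightarrow> complex \<times> real) \<Rightarrow> bool" where
  "circles_preserving F \<longleftrightarrow> bij_betw F heis_star heis_star \<and>
     (\<forall>\<zeta>\<in>left_half_plane. \<exists>\<eta>\<in>left_half_plane. F ` koranyi_fibre \<zeta> = koranyi_fibre \<eta>)"

end

theory Submission
  imports Defs
begin

text \<open>Write \<open>R = \<partial>/\<partial>\<theta>\<close> for the Reeb field of \<open>\<omega>\<^sup>* = d\<theta> + dt / (2|z|\<^sup>2)\<close>; the fibres of the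
  Koranyi map \<open>\<alpha>\<close> are its orbits. Taking exterior derivatives in \<open>F\<^sup>*\<omega>\<^sup>* = \<lambda>\<omega>\<^sup>*\<close> and contracting
  with \<open>R\<close> relates \<open>d\<lambda>\<close> to the derivative of \<open>\<alpha> \<circ> F\<close> along \<open>R\<close>. If \<open>\<lambda>\<close> is constant, the latter
  vanishes, so \<open>F\<close>, and likewise its inverse, maps fibres into fibres. Conversely, if \<open>F\<close> preserves
  fibres, then \<open>d\<lambda> = (R\<lambda>) \<omega>\<^sup>*\<close>. In particular \<open>\<lambda>\<close> does not change along the rays
  \<open>r \<mapsto> (r z, t)\<close>, whereas the ratio of the \<open>dt\<close> and \<open>d\<theta>\<close> coefficients of \<open>\<omega>\<^sup>*\<close> does, which
  forces \<open>d\<lambda> = 0\<close>. Since \<open>F\<close> is only \<open>C\<^sup>2\<close>, this replaces the usual argument via \<open>dd\<lambda> = 0\<close>.\<close>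

section \<open>Symmetry of the second derivative at a point\<close>

text \<open>The mean value inequality on [0, h], applied to the increment of \<open>f\<close> in
  direction \<open>w\<close> as the base point moves along \<open>v\<close>, minus its expected
  linear growth. Only the expansion of \<open>f'\<close> at the single point \<open>p\<close>
  enters.\<close>

lemma second_difference_bound:
  fixes f :: "'a::real_normed_vector \<Rightarrow> 'b::real_normed_vector"
  assumes f: "\<And>y. norm y < d \<Longrightarrow> (f has_derivative blinfun_apply (f' (p + y))) (at (p + y))"
    and f'': "bounded_linear f''"
    and R: "\<And>y. norm y < d \<Longrightarrow> norm (f' (p + y) - f' p - f'' y) \<le> e * norm y"
    and h: "0 < h" "h * (norm v + norm w) < d" and e: "0 \<le> e"
  shows "norm (f (p + h *\<^sub>R v + h *\<^sub>R w) - f (p + h *\<^sub>R v) - f (p + h *\<^sub>R w) + f p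
           - h\<^sup>2 *\<^sub>R blinfun_apply (f'' w) v)
         \<le> e * (2 * norm v + norm w) * norm v * h\<^sup>2"
proof -
  interpret f'': bounded_linear f'' by fact
  define A where "A = blinfun_apply (f'' w) v"
  define G where "G t = f (p + (t *\<^sub>R v + h *\<^sub>R w)) - f (p + t *\<^sub>R v) - (t * h) *\<^sub>R A" for t
  define G' where "G' t = blinfun_apply (f' (p + (t *\<^sub>R v + h *\<^sub>R w))) v
    - blinfun_apply (f' (p + t *\<^sub>R v)) v - h *\<^sub>R A" for t
  have small: "norm (t *\<^sub>R v + h *\<^sub>R w) \<le> h * (norm v + norm w)" "norm (t *\<^sub>R v) \<le> h * norm v"
    if "t \<in> {0..h}" for t
  proof -
    show "norm (t *\<^sub>R v) \<le> h * norm v" using that by (simp add: mult_right_mono)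
    then show "norm (t *\<^sub>R v + h *\<^sub>R w) \<le> h * (norm v + norm w)"
      using norm_triangle_ineq[of "t *\<^sub>R v" "h *\<^sub>R w"] h by (simp add: distrib_left)
  qed
  have "h * norm v \<le> h * (norm v + norm w)" using h by (intro mult_left_mono) auto
  then have less: "norm (t *\<^sub>R v + h *\<^sub>R w) < d" "norm (t *\<^sub>R v) < d" if "t \<in> {0..h}" for t
    using small[OF that] h(2) by linarith+
  have der: "(G has_derivative (\<lambda>s. s *\<^sub>R G' t)) (at t within {0..h})" if "t \<in> {0..h}" for t
  proof -
    have "((\<lambda>t. p + (t *\<^sub>R v + h *\<^sub>R w)) has_derivative (\<lambda>s. s *\<^sub>R v)) (at t within {0..h})"
      "((\<lambda>t. p + t *\<^sub>R v) has_derivative (\<lambda>s. s *\<^sub>R v)) (at t within {0..h})"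
      by (auto intro!: derivative_eq_intros)
    note 1 = has_derivative_compose[OF this(1) f[OF less(1)[OF that]]]
      and 2 = has_derivative_compose[OF this(2) f[OF less(2)[OF that]]]
    show ?thesis unfolding G_def
      by (rule has_derivative_eq_rhs, (rule derivative_intros 1 2)+)
        (auto simp: G'_def fun_eq_iff blinfun.scaleR_right algebra_simps)
  qed
  have bound: "norm (G' t) \<le> e * (2 * norm v + norm w) * norm v * h" if "t \<in> {0..h}" for t
  proof -
    let ?R = "\<lambda>y. f' (p + y) - f' p - f'' y"
    \<comment> \<open>The values \<open>f' p\<close> cancel and \<open>f''\<close> is linear, so
      only the difference of two remainders of \<open>f'\<close> survives.\<close>
    have "G' t = blinfun_apply (?R (t *\<^sub>R v + h *\<^sub>R w) - ?R (t *\<^sub>R v)) v"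
      by (simp add: G'_def A_def blinfun.bilinear_simps f''.add f''.scaleR)
    then have "norm (G' t) \<le> norm (?R (t *\<^sub>R v + h *\<^sub>R w) - ?R (t *\<^sub>R v)) * norm v"
      by (simp only: norm_blinfun)
    also have "\<dots> \<le> (e * (h * (norm v + norm w)) + e * (h * norm v)) * norm v"
    proof (rule mult_right_mono, rule order_trans[OF norm_triangle_ineq4], rule add_mono)
      show "norm (?R (t *\<^sub>R v + h *\<^sub>R w)) \<le> e * (h * (norm v + norm w))"
        using R[OF less(1)[OF that]] mult_left_mono[OF small(1)[OF that] e] by linarith
      show "norm (?R (t *\<^sub>R v)) \<le> e * (h * norm v)"
        using R[OF less(2)[OF that]] mult_left_mono[OF small(2)[OF that] e] by linarith
    qed auto
    finally show ?thesis by (simp add: algebra_simps)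
  qed
  have "norm (G h - G 0) \<le> e * (2 * norm v + norm w) * norm v * h * norm (h - 0)"
  proof (rule differentiable_bound[OF _ der])
    show "onorm (\<lambda>s. s *\<^sub>R G' t) \<le> e * (2 * norm v + norm w) * norm v * h" if "t \<in> {0..h}" for t
      using mult_left_mono[OF bound[OF that]] by (intro onorm_le) (simp add: mult.commute)
  qed (use h in auto)
  then show ?thesis
    using h by (simp add: G_def A_def power2_eq_square algebra_simps)
qed

text \<open>The second difference over the parallelogram spanned by \<open>h v\<close> and
  \<open>h w\<close> is symmetric in \<open>v\<close> and \<open>w\<close>, and
  \<open>second_difference_bound\<close> compares it with the second derivative taken in either
  order, up to a multiple of \<open>e * h\<^sup>2\<close>.\<close>

lemma second_derivative_symmetric:
  fixes f :: "'a::real_normed_vector \<Rightarrow> 'b::real_normed_vector"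
  assumes S: "open S" "p \<in> S"
    and f: "\<And>x. x \<in> S \<Longrightarrow> (f has_derivative blinfun_apply (f' x)) (at x)"
    and f': "(f' has_derivative f'') (at p)"
  shows "blinfun_apply (f'' v) w = blinfun_apply (f'' w) v"
proof -
  define K where "K = (2 * norm v + norm w) * norm v + (2 * norm w + norm v) * norm w"
  have K: "K \<ge> 0" by (simp add: K_def)
  have bl: "bounded_linear f''" using f' by (rule has_derivative_bounded_linear)
  have *: "norm (blinfun_apply (f'' v) w - blinfun_apply (f'' w) v) \<le> e * K" if e: "e > 0" for e
  proof -
    obtain d1 where d1: "d1 > 0" "ball p d1 \<subseteq> S" using S openE by blast
    obtain d2 where d2: "d2 > 0"
      "\<And>y. norm (y - p) < d2 \<Longrightarrow> norm (f' y - f' p - f'' (y - p)) \<le> e * norm (y - p)"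
      using f' e unfolding has_derivative_at_alt by blast
    define d where "d = min d1 d2"
    have fd: "(f has_derivative blinfun_apply (f' (p + y))) (at (p + y))" if "norm y < d" for y
      using that d1 by (intro f) (auto simp: d_def dist_norm subset_iff)
    have Rd: "norm (f' (p + y) - f' p - f'' y) \<le> e * norm y" if "norm y < d" for y
      using that d2(2)[of "p + y"] by (simp add: d_def)
    \<comment> \<open>The summand 1 makes \<open>hd\<close> strict and covers the case in which both
      vectors vanish.\<close>
    define h where "h = d / (norm v + norm w + 1)"
    have pos: "norm v + norm w + 1 > 0" by (simp add: add_nonneg_pos)
    have d: "d > 0" using d1 d2 by (simp add: d_def)
    then have h: "h > 0" using pos by (simp add: h_def)
    have hd: "h * (norm v + norm w) < d"
      using d pos by (simp add: h_def field_simps)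
    let ?D = "f (p + h *\<^sub>R v + h *\<^sub>R w) - f (p + h *\<^sub>R v) - f (p + h *\<^sub>R w) + f p"
    have 1: "norm (?D - h\<^sup>2 *\<^sub>R blinfun_apply (f'' w) v) \<le> e * (2 * norm v + norm w) * norm v * h\<^sup>2"
      using e by (intro second_difference_bound[OF fd bl Rd h hd]) auto
    have "norm (f (p + h *\<^sub>R w + h *\<^sub>R v) - f (p + h *\<^sub>R w) - f (p + h *\<^sub>R v) + f p
        - h\<^sup>2 *\<^sub>R blinfun_apply (f'' v) w) \<le> e * (2 * norm w + norm v) * norm w * h\<^sup>2"
      using e hd by (intro second_difference_bound[OF fd bl Rd h]) (auto simp: add.commute)
    then have 2: "norm (?D - h\<^sup>2 *\<^sub>R blinfun_apply (f'' v) w) \<le> e * (2 * norm w + norm v) * norm w * h\<^sup>2"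
      by (simp add: algebra_simps)
    have "norm (h\<^sup>2 *\<^sub>R (blinfun_apply (f'' v) w - blinfun_apply (f'' w) v)) \<le> h\<^sup>2 * (e * K)"
      using order_trans[OF norm_triangle_ineq4 add_mono[OF 1 2]]
      by (simp add: K_def algebra_simps del: norm_scaleR)
    then show ?thesis using h by simp
  qed
  have "norm (blinfun_apply (f'' v) w - blinfun_apply (f'' w) v) \<le> 0"
  proof (rule field_le_epsilon)
    fix e :: real assume "e > 0"
    then have "e / (K + 1) > 0" using K by simp
    from *[OF this] have "norm (blinfun_apply (f'' v) w - blinfun_apply (f'' w) v) \<le> e / (K + 1) * K" .
    also have "\<dots> \<le> e" using K \<open>e > 0\<close> by (simp add: field_simps)
    finally show "norm (blinfun_apply (f'' v) w - blinfun_apply (f'' w) v) \<le> 0 + e" by simp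
  qed
  then show ?thesis by simp
qed

section \<open>Contact forms and the Reeb field\<close>

lemma has_derivative_cmod_square:
  assumes "(g has_derivative g') (at p)"
  shows "((\<lambda>x. (cmod (g x))\<^sup>2) has_derivative (\<lambda>v. 2 * Re (cnj (g p) * g' v))) (at p)"
  unfolding cmod_power2
  by (rule has_derivative_eq_rhs, (rule derivative_intros assms)+) (simp add: algebra_simps)

text \<open>The standard contact form of the Heisenberg group. Its coefficients are affine in the
  base point, which makes it easier to differentiate than \<open>omega_star\<close>.\<close>

definition heis_form :: "complex \<times> real \<Rightarrow> complex \<times> real \<Rightarrow> real" where
  "heis_form q v = snd v + 2 * Im (cnj (fst q) * fst v)"

text \<open>The Reeb field of \<^const>\<open>omega_star\<close>.\<close>

definition reeb :: "complex \<times> real \<Rightarrow> complex \<times> real" where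
  "reeb p = (\<i> * fst p, 0)"

lemma omega_star_eq: "omega_star p v = heis_form p v / (2 * (cmod (fst p))\<^sup>2)"
  by (simp add: omega_star_def heis_form_def split_beta)

lemma heis_star_iff: "p \<in> heis_star \<longleftrightarrow> fst p \<noteq> 0"
  by (cases p) (auto simp: heis_star_def)

lemma open_heis_star: "open heis_star"
  by (simp add: heis_star_def open_Times open_delete)

lemma connected_heis_star: "connected heis_star"
  unfolding heis_star_def
  by (intro connected_Times) (auto simp: Compl_eq_Diff_UNIV[symmetric] connected_punctured_universe)

lemma heis_form_reeb: "heis_form p (reeb p) = 2 * (cmod (fst p))\<^sup>2"
  unfolding cmod_power2 by (simp add: heis_form_def reeb_def power2_eq_square)

lemma omega_star_reeb: "p \<in> heis_star \<Longrightarrow> omega_star p (reeb p) = 1"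
  by (simp add: omega_star_eq heis_form_reeb heis_star_iff)

section \<open>Contact maps and their conformal factor\<close>

text \<open>The setting shared by a contact diffeomorphism and its inverse: the final proof
  instantiates it with both, the inverse carrying the reciprocal factor.\<close>

locale contact_map =
  fixes F :: "complex \<times> real \<Rightarrow> complex \<times> real"
    and D :: "complex \<times> real \<Rightarrow> (complex \<times> real) \<Rightarrow>\<^sub>L (complex \<times> real)"
    and lam :: "complex \<times> real \<Rightarrow> real"
  assumes maps: "p \<in> heis_star \<Longrightarrow> F p \<in> heis_star"
    and deriv: "p \<in> heis_star \<Longrightarrow> (F has_derivative blinfun_apply (D p)) (at p)"
    and deriv2: "p \<in> heis_star \<Longrightarrow> D differentiable (at p)"
    and contact: "p \<in> heis_star \<Longrightarrow> omega_star (F p) (blinfun_apply (D p) v) = lam p * omega_star p v"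
begin

lemma lam_eq: "p \<in> heis_star \<Longrightarrow> lam p = omega_star (F p) (blinfun_apply (D p) (reeb p))"
  by (simp add: contact omega_star_reeb)

lemma deriv_fst: "p \<in> heis_star \<Longrightarrow> ((\<lambda>x. fst (F x)) has_derivative (\<lambda>v. fst (blinfun_apply (D p) v))) (at p)"
  and deriv_snd: "p \<in> heis_star \<Longrightarrow> ((\<lambda>x. snd (F x)) has_derivative (\<lambda>v. snd (blinfun_apply (D p) v))) (at p)"
  using has_derivative_fst[OF deriv] has_derivative_snd[OF deriv] by auto

text \<open>Evaluating the contact equation on the Reeb field, as in \<open>lam_eq\<close>,
  expresses \<open>lam\<close> through \<open>F\<close> and \<open>D\<close>, which are both
  differentiable.\<close>

lemma lam_differentiable:
  assumes p: "p \<in> heis_star" shows "lam differentiable (at p)"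
proof -
  obtain D2 where D2: "(D has_derivative D2) (at p)"
    using deriv2[OF p] by (auto simp: differentiable_def)
  have r: "((\<lambda>x. reeb x) has_derivative (\<lambda>v. (\<i> * fst v, 0))) (at p)"
    unfolding reeb_def by (auto intro!: derivative_eq_intros)
  note Dr = bounded_bilinear.FDERIV[OF bounded_bilinear_blinfun_apply D2 r]
  have "(\<lambda>x. cnj (fst (F x)) * fst (blinfun_apply (D x) (reeb x))) differentiable (at p)"
    by (intro differentiable_mult differentiableI[OF has_derivative_cnj[OF deriv_fst[OF p]]]
        differentiableI[OF has_derivative_fst[OF Dr]])
  then obtain N where "((\<lambda>x. cnj (fst (F x)) * fst (blinfun_apply (D x) (reeb x))) has_derivative N) (at p)"
    by (auto simp: differentiable_def)
  note N = has_derivative_add[OF has_derivative_snd[OF Dr] has_derivative_mult_right[OF has_derivative_Im[OF this], of 2]]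
  have "2 * (cmod (fst (F p)))\<^sup>2 \<noteq> 0" using maps[OF p] by (simp add: heis_star_iff)
  from has_derivative_divide'[OF N has_derivative_mult_right[OF has_derivative_cmod_square[OF deriv_fst[OF p]]] this]
  obtain g' where "((\<lambda>x. omega_star (F x) (blinfun_apply (D x) (reeb x))) has_derivative g') (at p)"
    by (simp add: omega_star_eq heis_form_def)
  then have "(lam has_derivative g') (at p)"
    by (rule has_derivative_transform_within_open[OF _ open_heis_star p]) (simp add: lam_eq)
  then show ?thesis by (auto simp: differentiable_def)
qed

text \<open>The exterior derivative of \<open>F\<^sup>* \<eta> = m \<eta>\<close> for the form \<open>\<eta> = heis_form\<close>, which differs
  from \<^const>\<open>omega_star\<close> by a conformal factor and has constant exterior derivative.\<close>

lemma structure_equation: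
  assumes p: "p \<in> heis_star"
    and m: "\<And>x v. x \<in> heis_star \<Longrightarrow> heis_form (F x) (blinfun_apply (D x) v) = m x * heis_form x v"
    and m': "(m has_derivative M) (at p)"
  shows "4 * Im (cnj (fst (blinfun_apply (D p) w)) * fst (blinfun_apply (D p) v))
    = M w * heis_form p v - M v * heis_form p w + 4 * m p * Im (cnj (fst w) * fst v)"
proof -
  obtain D2 where D2: "(D has_derivative D2) (at p)"
    using deriv2[OF p] by (auto simp: differentiable_def)
  have sym: "blinfun_apply (D2 v) w = blinfun_apply (D2 w) v"
    by (rule second_derivative_symmetric[OF open_heis_star p deriv D2])
  \<comment> \<open>Both sides are the derivative in direction \<open>w\<close> of the contact
    equation evaluated on the fixed vector \<open>v\<close>.\<close>
  have eq: "snd (blinfun_apply (D2 w) v) + 2 * (Im (cnj (fst (F p)) * fst (blinfun_apply (D2 w) v))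
      + Im (cnj (fst (blinfun_apply (D p) w)) * fst (blinfun_apply (D p) v)))
    = M w * heis_form p v + m p * (2 * Im (cnj (fst w) * fst v))" for v w
  proof -
    note Dv = bounded_bilinear.FDERIV[OF bounded_bilinear_blinfun_apply D2 has_derivative_const[of v]]
    have "((\<lambda>x. heis_form (F x) (blinfun_apply (D x) v)) has_derivative
       (\<lambda>w. snd (blinfun_apply (D2 w) v) + 2 * (Im (cnj (fst (F p)) * fst (blinfun_apply (D2 w) v))
      + Im (cnj (fst (blinfun_apply (D p) w)) * fst (blinfun_apply (D p) v))))) (at p)"
      unfolding heis_form_def
      by (rule has_derivative_eq_rhs,
         (rule derivative_intros has_derivative_fst[OF Dv] has_derivative_snd[OF Dv] deriv_fst[OF p])+)
        (auto simp: fun_eq_iff blinfun.zero_right)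
    then have 1: "((\<lambda>x. m x * heis_form x v) has_derivative
       (\<lambda>w. snd (blinfun_apply (D2 w) v) + 2 * (Im (cnj (fst (F p)) * fst (blinfun_apply (D2 w) v))
      + Im (cnj (fst (blinfun_apply (D p) w)) * fst (blinfun_apply (D p) v))))) (at p)"
      by (rule has_derivative_transform_within_open[OF _ open_heis_star p]) (simp add: m)
    have 2: "((\<lambda>x. m x * heis_form x v) has_derivative
       (\<lambda>w. M w * heis_form p v + m p * (2 * Im (cnj (fst w) * fst v)))) (at p)"
      unfolding heis_form_def
      by (rule has_derivative_eq_rhs, (rule derivative_intros m')+) (auto simp: fun_eq_iff)
    show ?thesis by (rule fun_cong[OF has_derivative_unique[OF 1 2]])
  qed
  \<comment> \<open>Exchanging \<open>v\<close> and \<open>w\<close> and subtracting cancels the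
    second derivatives of \<open>F\<close>; the \<open>Im\<close> terms are antisymmetric and
    therefore double.\<close>
  show ?thesis
    using eq[of w v] eq[of v w] sym by (simp add: algebra_simps)
qed

text \<open>This is \<open>structure_equation\<close> contracted with the Reeb field and rewritten
  in terms of \<open>omega_star\<close>. It links the differential \<open>L\<close> of the factor to
  the image of the Reeb field under \<open>D p\<close>.\<close>

lemma reeb_identity:
  assumes p: "p \<in> heis_star" and L: "(lam has_derivative L) (at p)"
  defines "U \<equiv> (cmod (fst (F p)))\<^sup>2"
    and "U' \<equiv> (\<lambda>v. 2 * Re (cnj (fst (F p)) * fst (blinfun_apply (D p) v)))"
  shows "4 * Im (cnj (fst (blinfun_apply (D p) (reeb p))) * fst (blinfun_apply (D p) v))
    = 2 * (L (reeb p) * U + lam p * U' (reeb p)) * omega_star p v - 2 * U * L v - 2 * lam p * U' v"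
proof -
  define u where "u = (cmod (fst p))\<^sup>2"
  define u' where "u' v = 2 * Re (cnj (fst p) * fst v)" for v :: "complex \<times> real"
  \<comment> \<open>The factor of \<open>F\<close> with respect to \<open>heis_form\<close>,
    obtained by clearing the denominators of \<open>omega_star\<close> at \<open>p\<close> and at
    \<open>F p\<close>.\<close>
  define m where "m x = lam x * (cmod (fst (F x)))\<^sup>2 / (cmod (fst x))\<^sup>2" for x
  define M where "M v = (L v * U + lam p * U' v) / u - lam p * U * u' v / u\<^sup>2" for v
  have u: "u > 0" using p by (simp add: u_def heis_star_iff)
  have mc: "heis_form (F x) (blinfun_apply (D x) v) = m x * heis_form x v" if "x \<in> heis_star" for x v
    using contact[OF that, of v] that maps[OF that]
    by (simp add: omega_star_eq m_def heis_star_iff field_simps)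
  have m': "(m has_derivative M) (at p)"
    unfolding m_def
  proof (rule has_derivative_eq_rhs)
    note dU = has_derivative_cmod_square[OF deriv_fst[OF p]]
      and du = has_derivative_cmod_square[OF has_derivative_fst[OF has_derivative_ident]]
    have "(cmod (fst p))\<^sup>2 \<noteq> 0" using u by (simp add: u_def)
    then show "((\<lambda>x. lam x * (cmod (fst (F x)))\<^sup>2 / (cmod (fst x))\<^sup>2) has_derivative
       (\<lambda>v. ((lam p * U' v + L v * U) * u - lam p * U * u' v) / (u * u))) (at p)"
      using has_derivative_divide'[OF has_derivative_mult[OF L dU] du]
      by (simp add: U_def U'_def u_def u'_def)
    show "(\<lambda>v. ((lam p * U' v + L v * U) * u - lam p * U * u' v) / (u * u)) = M"
      using u by (simp add: fun_eq_iff M_def field_simps power2_eq_square)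
  qed
  have "4 * Im (cnj (fst (blinfun_apply (D p) (reeb p))) * fst (blinfun_apply (D p) v))
     = M (reeb p) * heis_form p v - M v * heis_form p (reeb p) + 4 * m p * Im (cnj (fst (reeb p)) * fst v)"
    by (rule structure_equation[OF p mc m'])
  \<comment> \<open>The Reeb flow rotates \<open>z\<close>, so \<open>u'\<close> vanishes on
    \<open>reeb p\<close>.\<close>
  also have "M (reeb p) * heis_form p v = 2 * (L (reeb p) * U + lam p * U' (reeb p)) * omega_star p v"
    using u by (simp add: M_def u'_def reeb_def omega_star_eq u_def[symmetric] field_simps)
  also have "M v * heis_form p (reeb p) = 2 * U * L v + 2 * lam p * U' v - 2 * lam p * U / u * u' v"
  proof -
    have "heis_form p (reeb p) = 2 * u" by (simp add: heis_form_reeb u_def)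
    then show ?thesis using u by (simp add: M_def field_simps power2_eq_square)
  qed
  \<comment> \<open>This cancels the \<open>u'\<close> term left over from the preceding
    step.\<close>
  also have "4 * m p * Im (cnj (fst (reeb p)) * fst v) = - 2 * lam p * U / u * u' v"
    using u by (simp add: m_def U_def u_def u'_def reeb_def field_simps)
  finally show ?thesis by simp
qed

text \<open>The derivative of \<open>koranyi_map \<circ> F\<close> along the Reeb field.\<close>

definition koranyi_speed :: "complex \<times> real \<Rightarrow> complex" where
  "koranyi_speed p = - of_real (2 * Re (cnj (fst (F p)) * fst (blinfun_apply (D p) (reeb p))))
    + \<i> * of_real (snd (blinfun_apply (D p) (reeb p)))"

lemma koranyi_speed_eq_0_iff:
  "koranyi_speed p = 0 \<longleftrightarrow>
    Re (cnj (fst (F p)) * fst (blinfun_apply (D p) (reeb p))) = 0 \<and> snd (blinfun_apply (D p) (reeb p)) = 0"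
  by (auto simp: koranyi_speed_def complex_eq_iff)

text \<open>The curve \<open>s \<mapsto> (cis s * z, t)\<close> is an integral curve of the Reeb
  field, so the chain rule applies.\<close>

lemma koranyi_along_fibre:
  assumes "z \<noteq> 0"
  shows "((\<lambda>s. koranyi_map (F (cis s * z, t))) has_vector_derivative koranyi_speed (cis s * z, t)) (at s)"
proof -
  let ?p = "(cis s * z, t)"
  have p: "?p \<in> heis_star" using assms by (simp add: heis_star_iff)
  have k: "koranyi_map = (\<lambda>q. - of_real ((cmod (fst q))\<^sup>2) + \<i> * of_real (snd q))"
    by (simp add: koranyi_map_def fun_eq_iff)
  have c: "((\<lambda>s. (cis s * z, t)) has_derivative (\<lambda>h. h *\<^sub>R reeb ?p)) (at s)"
    by (rule has_derivative_eq_rhs, (rule derivative_intros)+)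
      (simp add: fun_eq_iff reeb_def scaleR_conv_of_real)
  have "((\<lambda>x. koranyi_map (F x)) has_derivative
     (\<lambda>v. - of_real (2 * Re (cnj (fst (F ?p)) * fst (blinfun_apply (D ?p) v)))
       + \<i> * of_real (snd (blinfun_apply (D ?p) v)))) (at ?p)"
    unfolding k
    by (intro has_derivative_add has_derivative_minus has_derivative_of_real has_derivative_mult_right
        has_derivative_cmod_square deriv_fst[OF p] deriv_snd[OF p])
  from has_derivative_compose[OF c this] show ?thesis
    unfolding has_vector_derivative_def
    by (rule has_derivative_eq_rhs)
      (simp add: fun_eq_iff koranyi_speed_def blinfun.scaleR_right scaleR_conv_of_real algebra_simps)
qed

text \<open>Without the \<open>L\<close> terms, \<open>reeb_identity\<close> involves only the image
  vector \<open>D p v\<close>, and surjectivity lets this be any vector at \<open>F p\<close>.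
  Suitable test vectors then determine \<open>D p (reeb p)\<close>.\<close>

lemma const_factor_imp_koranyi_speed_eq_0:
  assumes p: "p \<in> heis_star" and L: "(lam has_derivative (\<lambda>v. 0)) (at p)" and lam: "lam p \<noteq> 0"
    and surj: "surj (blinfun_apply (D p))"
  shows "koranyi_speed p = 0"
proof -
  define Z where "Z = fst (F p)"
  define W where "W = fst (blinfun_apply (D p) (reeb p))"
  have Z: "Z \<noteq> 0" using maps[OF p] by (simp add: Z_def heis_star_iff)
  have eq: "4 * Im (cnj W * fst v) = 4 * Re (cnj Z * W) * omega_star (F p) v - 4 * lam p * Re (cnj Z * fst v)" for v
  proof -
    obtain v' where v: "v = blinfun_apply (D p) v'" using surj by (metis surjD)
    show ?thesis
      using reeb_identity[OF p L, of v'] contact[OF p, of v'] by (simp add: v Z_def W_def algebra_simps)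
  qed
  \<comment> \<open>The vertical vector \<open>(0, 1)\<close> has no complex component but nonzero
    \<open>omega_star\<close>, which isolates this coefficient.\<close>
  have re: "Re (cnj Z * W) = 0"
    using eq[of "(0, 1)"] Z by (simp add: omega_star_eq heis_form_def Z_def)
  then have *: "Im (cnj W * x) = - lam p * Re (cnj Z * x)" for x
    using eq[of "(x, 0)"] by simp
  have "W = \<i> * lam p * Z"
    using *[of 1] *[of \<i>] by (simp add: complex_eq_iff)
  then have "Im (cnj Z * W) = lam p * (cmod Z)\<^sup>2"
    unfolding cmod_power2 by (simp add: algebra_simps power2_eq_square)
  \<comment> \<open>The complex component \<open>W\<close> already accounts for the whole value
    \<open>lam p\<close> of \<open>omega_star\<close> on the image of the Reeb vector, so the real
    component must vanish.\<close>
  moreover have "lam p * (2 * (cmod Z)\<^sup>2) = snd (blinfun_apply (D p) (reeb p)) + 2 * Im (cnj Z * W)"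
    using lam_eq[OF p] Z by (simp add: omega_star_eq heis_form_def Z_def W_def)
  ultimately show ?thesis
    using re by (simp add: koranyi_speed_eq_0_iff Z_def W_def)
qed

text \<open>Zero speed together with \<open>lam_eq\<close> forces
  \<open>D p (reeb p) = lam p *\<^sub>R reeb (F p)\<close>. The left side of
  \<open>reeb_identity\<close> then cancels its last term, and what remains is divisible by
  \<open>2 * U\<close>.\<close>

lemma koranyi_speed_eq_0_imp:
  assumes p: "p \<in> heis_star" and L: "(lam has_derivative L) (at p)" and k: "koranyi_speed p = 0"
  shows "L v = L (reeb p) * omega_star p v"
proof -
  define Z where "Z = fst (F p)"
  define W where "W = fst (blinfun_apply (D p) (reeb p))"
  define U where "U = (cmod Z)\<^sup>2"
  have Z: "Z \<noteq> 0" using maps[OF p] by (simp add: Z_def heis_star_iff)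
  then have U: "U \<noteq> 0" by (simp add: U_def)
  have re: "Re (cnj Z * W) = 0" and sn: "snd (blinfun_apply (D p) (reeb p)) = 0"
    using k by (auto simp: koranyi_speed_eq_0_iff Z_def W_def)
  have "Im (cnj Z * W) = lam p * U"
    using lam_eq[OF p] Z sn by (simp add: omega_star_eq heis_form_def Z_def W_def U_def)
  with re have "cnj Z * W = \<i> * lam p * U" by (simp add: complex_eq_iff)
  also have "\<dots> = cnj Z * (\<i> * lam p * Z)"
    by (simp add: U_def complex_norm_square[unfolded of_real_power])
  finally have "W = \<i> * lam p * Z" using Z by simp
  then have "4 * Im (cnj W * fst (blinfun_apply (D p) v)) = - 4 * lam p * Re (cnj Z * fst (blinfun_apply (D p) v))"
    by (simp add: algebra_simps)
  moreover have "4 * Im (cnj W * fst (blinfun_apply (D p) v))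
      = 2 * (L (reeb p) * U) * omega_star p v - 2 * U * L v - 4 * lam p * Re (cnj Z * fst (blinfun_apply (D p) v))"
    using reeb_identity[OF p L, of v] unfolding Z_def[symmetric] W_def[symmetric] U_def[symmetric] re by simp
  ultimately have "2 * U * L v = 2 * U * (L (reeb p) * omega_star p v)"
    by (simp add: algebra_simps)
  then show ?thesis using U by simp
qed

end

section \<open>Fibres of the Koranyi map\<close>

lemma koranyi_map_eq_iff:
  "koranyi_map p = koranyi_map q \<longleftrightarrow> cmod (fst p) = cmod (fst q) \<and> snd p = snd q"
  by (cases p; cases q) (auto simp: koranyi_map_def complex_eq_iff simp flip: of_real_power)

lemma koranyi_map_eqE:
  assumes "p \<in> heis_star" "koranyi_map p = koranyi_map q"
  obtains s where "q = (cis s * fst p, snd p)"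
proof -
  define w where "w = fst q / fst p"
  have z: "fst p \<noteq> 0" and eq: "cmod (fst p) = cmod (fst q)" "snd p = snd q"
    using assms by (simp_all add: heis_star_iff koranyi_map_eq_iff)
  have "cmod w = 1" using z by (simp add: w_def norm_divide flip: eq(1))
  then have "w = cis (Arg w)" using rcis_cmod_Arg[of w] by (simp add: rcis_def)
  moreover have "fst q = w * fst p" using z by (simp add: w_def)
  ultimately have "fst q = cis (Arg w) * fst p" by (rule subst)
  then show ?thesis using that[of "Arg w"] eq(2) by (simp add: prod_eq_iff)
qed

lemma koranyi_map_in_left_half_plane: "p \<in> heis_star \<Longrightarrow> koranyi_map p \<in> left_half_plane"
  by (cases p) (simp add: koranyi_map_def left_half_plane_def heis_star_iff flip: of_real_power)

lemma koranyi_map_surj: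
  assumes "\<zeta> \<in> left_half_plane"
  obtains p where "p \<in> heis_star" "koranyi_map p = \<zeta>"
proof
  let ?p = "(complex_of_real (sqrt (- Re \<zeta>)), Im \<zeta>)"
  show "?p \<in> heis_star" "koranyi_map ?p = \<zeta>"
    using assms by (simp_all add: heis_star_iff left_half_plane_def koranyi_map_def complex_eq_iff
        flip: of_real_power)
qed

lemma cis_in_koranyi_fibre:
  "z \<noteq> 0 \<Longrightarrow> (cis s * z, t) \<in> koranyi_fibre (koranyi_map (z, t))"
  by (simp add: koranyi_fibre_def heis_star_iff koranyi_map_eq_iff norm_mult)

section \<open>From infinitesimal to global statements\<close>

context contact_map
begin

text \<open>Each fibre is a single Reeb orbit, along which \<open>koranyi_map \<circ> F\<close> has
  zero derivative. This yields an inclusion of fibres; equality comes later from the same lemma for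
  the inverse.\<close>

lemma const_factor_imp_fibres:
  assumes lam: "\<And>p. p \<in> heis_star \<Longrightarrow> lam p = c" and c: "c \<noteq> 0"
    and surj: "\<And>p. p \<in> heis_star \<Longrightarrow> surj (blinfun_apply (D p))"
    and pq: "p \<in> heis_star" "koranyi_map p = koranyi_map q"
  shows "koranyi_map (F p) = koranyi_map (F q)"
proof -
  obtain s where q: "q = (cis s * fst p, snd p)" using koranyi_map_eqE[OF pq] .
  have z: "fst p \<noteq> 0" using pq by (simp add: heis_star_iff)
  have "koranyi_speed x = 0" if x: "x \<in> heis_star" for x
  proof (rule const_factor_imp_koranyi_speed_eq_0[OF x _ _ surj[OF x]])
    show "(lam has_derivative (\<lambda>v. 0)) (at x)"
      by (rule has_derivative_transform_within_open[OF has_derivative_const open_heis_star x])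
        (simp add: lam)
  qed (simp add: lam x c)
  then have "((\<lambda>s. koranyi_map (F (cis s * fst p, snd p))) has_derivative (\<lambda>h. 0)) (at s)" for s
    using koranyi_along_fibre[OF z, of "snd p" s] z
    by (simp add: has_vector_derivative_def heis_star_iff)
  then have "koranyi_map (F (cis 0 * fst p, snd p)) = koranyi_map (F (cis s * fst p, snd p))"
    by (intro has_derivative_zero_unique_connected[where s = UNIV
          and f = "\<lambda>s. koranyi_map (F (cis s * fst p, snd p))"]) auto
  then show ?thesis by (simp add: q)
qed

lemma fibres_imp_const_factor:
  assumes fib: "\<And>\<zeta>. \<zeta> \<in> left_half_plane \<Longrightarrow> \<exists>\<eta>. F ` koranyi_fibre \<zeta> \<subseteq> koranyi_fibre \<eta>"
  shows "lam constant_on heis_star"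
proof -
  define L where "L p = frechet_derivative lam (at p)" for p
  have L: "(lam has_derivative L p) (at p)" if "p \<in> heis_star" for p
    unfolding L_def using lam_differentiable[OF that] by (simp add: frechet_derivative_works)
  have "koranyi_speed p = 0" if p: "p \<in> heis_star" for p
  proof -
    obtain z t where zt: "p = (z, t)" "z \<noteq> 0" using p by (cases p) (auto simp: heis_star_iff)
    obtain \<eta> where "F ` koranyi_fibre (koranyi_map p) \<subseteq> koranyi_fibre \<eta>"
      using fib[OF koranyi_map_in_left_half_plane[OF p]] by blast
    then have "koranyi_map (F (cis s * z, t)) = \<eta>" for s
      using cis_in_koranyi_fibre[OF zt(2), of s t] by (auto simp: zt koranyi_fibre_def)
    \<comment> \<open>A function constant along the orbit has derivative 0, which uniqueness
      identifies with \<open>koranyi_speed p\<close>.\<close>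
    then have "((\<lambda>s. koranyi_map (F (cis s * z, t))) has_vector_derivative 0) (at 0)"
      by simp
    then show ?thesis
      using vector_derivative_unique_at[OF koranyi_along_fibre[OF zt(2), of t 0]] by (simp add: zt)
  qed
  then have Lw: "L p v = L p (reeb p) * omega_star p v" if "p \<in> heis_star" for p v
    using koranyi_speed_eq_0_imp[OF that L[OF that]] that by blast
  have dil: "lam (2 * z, t) = lam (z, t)" if z: "z \<noteq> 0" for z t
  proof -
    have d: "((\<lambda>r. lam (of_real r * z, t)) has_derivative (\<lambda>h. 0)) (at r)" if r: "r \<in> {0<..}" for r
    proof -
      let ?p = "(of_real r * z, t)"
      have p: "?p \<in> heis_star" using z r by (simp add: heis_star_iff)
      have ray: "((\<lambda>r. (of_real r * z, t)) has_derivative (\<lambda>h. (of_real h * z, 0))) (at r)"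
        by (auto intro!: derivative_eq_intros)
      \<comment> \<open>Radial vectors lie in the kernel of \<open>omega_star\<close>, since
        \<open>cnj z * z\<close> is real.\<close>
      have "L ?p (of_real h * z, 0) = 0" for h
        by (subst Lw[OF p]) (simp add: omega_star_eq heis_form_def)
      then show ?thesis
        using has_derivative_compose[OF ray L[OF p]] by simp
    qed
    have "lam (of_real 2 * z, t) = lam (of_real 1 * z, t)"
      by (rule has_derivative_zero_unique_connected[OF open_greaterThan connected_Ioi d]) auto
    then show ?thesis by simp
  qed
  have "L p = (\<lambda>v. 0)" if p: "p \<in> heis_star" for p
  proof -
    \<comment> \<open>The dilation by 2 preserves \<open>lam\<close> and the Reeb field, and it
      fixes the vector \<open>(0, 1)\<close>. The value of \<open>omega_star\<close> on that vector
      is divided by 4, however, so the common coefficient \<open>L p (reeb p)\<close> must be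
      0.\<close>
    let ?d = "\<lambda>p :: complex \<times> real. (2 * fst p, snd p)"
    have p2: "?d p \<in> heis_star" using p by (simp add: heis_star_iff)
    have "(?d has_derivative ?d) (at p)" by (auto intro!: derivative_eq_intros)
    from has_derivative_compose[OF this L[OF p2]]
    have "((\<lambda>x. lam (?d x)) has_derivative (\<lambda>v. L (?d p) (?d v))) (at p)" .
    then have "(lam has_derivative (\<lambda>v. L (?d p) (?d v))) (at p)"
      by (rule has_derivative_transform_within_open[OF _ open_heis_star p])
        (simp add: dil heis_star_iff)
    then have eq: "L p v = L (?d p) (?d v)" for v
      by (rule fun_cong[OF has_derivative_unique[OF L[OF p]]])
    have "?d (reeb p) = reeb (?d p)" by (simp add: reeb_def)
    then have "L (?d p) (reeb (?d p)) = L p (reeb p)" using eq[of "reeb p"] by simp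
    then have "L p (reeb p) * omega_star p (0, 1) = L p (reeb p) * omega_star (?d p) (0, 1)"
      using eq[of "(0, 1)"] Lw[OF p, of "(0, 1)"] Lw[OF p2, of "(0, 1)"] by simp
    moreover have "omega_star p (0, 1) \<noteq> omega_star (?d p) (0, 1)"
      using p by (simp add: omega_star_eq heis_form_def heis_star_iff norm_mult power_mult_distrib)
    ultimately have "L p (reeb p) = 0" by simp
    then show ?thesis by (intro ext) (subst Lw[OF p], simp)
  qed
  with L have "(lam has_derivative (\<lambda>v. 0)) (at p)" if "p \<in> heis_star" for p
    using that by fastforce
  then have "lam p = lam (1, 0)" if "p \<in> heis_star" for p
    by (rule has_derivative_zero_unique_connected[OF open_heis_star connected_heis_star _ that])
      (simp_all add: heis_star_iff)
  then show ?thesis unfolding constant_on_def by blast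
qed

end

section \<open>The inverse map and the equivalence\<close>

lemma C2_onE:
  assumes "C2_on S f"
  obtains D where "\<And>x. x \<in> S \<Longrightarrow> (f has_derivative blinfun_apply (D x)) (at x)"
    and "\<And>x. x \<in> S \<Longrightarrow> D differentiable (at x)"
proof -
  from assms obtain D where D: "\<forall>x\<in>S. (f has_derivative blinfun_apply (D x)) (at x)" "C1_on S D"
    unfolding C2_on_def by blast
  from D(2) obtain D2 where "\<forall>x\<in>S. (D has_derivative blinfun_apply (D2 x)) (at x)"
    unfolding C1_on_def by blast
  then have "D differentiable (at x)" if "x \<in> S" for x
    using that differentiableI by blast
  with D(1) show ?thesis using that[of D] by simp
qed

lemma inverse_derivatives:
  assumes "open S" "x \<in> S" "\<And>y. y \<in> S \<Longrightarrow> g (f y) = y"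
    and "(f has_derivative f') (at x)" "(g has_derivative g') (at (f x))"
  shows "g' (f' v) = v"
proof -
  have "((\<lambda>y. g (f y)) has_derivative (\<lambda>v. g' (f' v))) (at x)"
    by (rule has_derivative_compose[OF assms(4,5)])
  then have "((\<lambda>y. y) has_derivative (\<lambda>v. g' (f' v))) (at x)"
    by (rule has_derivative_transform_within_open[OF _ assms(1,2)]) (simp add: assms(3))
  from has_derivative_unique[OF this has_derivative_ident] show ?thesis by (rule fun_cong)
qed

theorem corollary6p4:
  fixes F :: "complex \<times> real \<Rightarrow> complex \<times> real"
    and lam :: "complex \<times> real \<Rightarrow> real"
  assumes "op_C2_contact_diffeo F"
    and "contact_factor F lam"
  shows "lam constant_on heis_star \<longleftrightarrow> circles_preserving F"
proof -
  define G where "G = inv_into heis_star F"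
  have bij: "bij_betw F heis_star heis_star" and C2: "C2_on heis_star F" "C2_on heis_star G"
    using assms(1) by (auto simp: op_C2_contact_diffeo_def C2_diffeo_on_def G_def)
  have G: "G q \<in> heis_star" "F (G q) = q" if "q \<in> heis_star" for q
    using bij that unfolding G_def
    by (simp_all add: bij_betw_def inv_into_into f_inv_into_f)
  have F: "F p \<in> heis_star" "G (F p) = p" if "p \<in> heis_star" for p
    using bij that unfolding G_def by (auto simp: bij_betw_def)
  obtain D where D: "\<And>x. x \<in> heis_star \<Longrightarrow> (F has_derivative blinfun_apply (D x)) (at x)"
    "\<And>x. x \<in> heis_star \<Longrightarrow> D differentiable (at x)" using C2_onE[OF C2(1)] by blast
  obtain E where E: "\<And>x. x \<in> heis_star \<Longrightarrow> (G has_derivative blinfun_apply (E x)) (at x)"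
    "\<And>x. x \<in> heis_star \<Longrightarrow> E differentiable (at x)" using C2_onE[OF C2(2)] by blast
  \<comment> \<open>The differentials of \<open>F\<close> and \<open>G\<close> are mutually inverse,
    which gives the surjectivity required below and the contact equation for
    \<open>G\<close>.\<close>
  have ED: "blinfun_apply (E (F p)) (blinfun_apply (D p) v) = v" if "p \<in> heis_star" for p v
    by (rule inverse_derivatives[OF open_heis_star that F(2) D(1)[OF that] E(1)[OF F(1)[OF that]]])
  have DE: "blinfun_apply (D (G q)) (blinfun_apply (E q) v) = v" if "q \<in> heis_star" for q v
    by (rule inverse_derivatives[OF open_heis_star that G(2) E(1)[OF that] D(1)[OF G(1)[OF that]]])
  have pos: "lam p > 0" if "p \<in> heis_star" for p
    using assms(2) that by (simp add: contact_factor_def)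
  have ct: "omega_star (F p) (blinfun_apply (D p) v) = lam p * omega_star p v" if "p \<in> heis_star" for p v
    using assms(2) that frechet_derivative_at[OF D(1)[OF that]]
    by (simp add: contact_factor_def pullback_form_def del: split_paired_All)
  interpret F: contact_map F D lam
    by unfold_locales (use F D ct in auto)
  interpret G: contact_map G E "\<lambda>q. 1 / lam (G q)"
  proof unfold_locales
    fix q v assume q: "q \<in> heis_star"
    show "omega_star (G q) (blinfun_apply (E q) v) = 1 / lam (G q) * omega_star q v"
      using ct[OF G(1)[OF q], of "blinfun_apply (E q) v"] pos[OF G(1)[OF q]] q
      by (simp add: G DE)
  qed (use G E in auto)
  show ?thesis
  proof
    assume "lam constant_on heis_star"
    then obtain c where c: "\<And>p. p \<in> heis_star \<Longrightarrow> lam p = c" unfolding constant_on_def by blast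
    have "(1, 0) \<in> heis_star" by (simp add: heis_star_iff)
    then have c0: "c \<noteq> 0" using c pos by fastforce
    have Fk: "koranyi_map (F p) = koranyi_map (F q)"
      if "p \<in> heis_star" "koranyi_map p = koranyi_map q" for p q
    proof (rule F.const_factor_imp_fibres[OF c c0 _ that])
      fix x assume x: "x \<in> heis_star"
      show "surj (blinfun_apply (D x))"
        by (rule surjI[where f = "blinfun_apply (E (F x))"]) (use DE[OF F(1)[OF x]] F(2)[OF x] in simp)
    qed
    \<comment> \<open>The inverse also has a constant factor, namely \<open>1 / c\<close>.\<close>
    have Gk: "koranyi_map (G p) = koranyi_map (G q)"
      if "p \<in> heis_star" "koranyi_map p = koranyi_map q" for p q
    proof (rule G.const_factor_imp_fibres[OF _ _ _ that])
      fix x assume x: "x \<in> heis_star"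
      show "1 / lam (G x) = 1 / c" using c G(1)[OF x] by simp
      show "surj (blinfun_apply (E x))"
        by (rule surjI[where f = "blinfun_apply (D (G x))"]) (use ED[OF G(1)[OF x]] G(2)[OF x] in simp)
    qed (simp add: c0)
    show "circles_preserving F"
      unfolding circles_preserving_def
    proof (intro conjI bij ballI)
      fix \<zeta> assume "\<zeta> \<in> left_half_plane"
      then obtain p where p: "p \<in> heis_star" "koranyi_map p = \<zeta>" using koranyi_map_surj by blast
      have "F ` koranyi_fibre \<zeta> \<subseteq> koranyi_fibre (koranyi_map (F p))"
      proof (rule image_subsetI)
        fix q assume "q \<in> koranyi_fibre \<zeta>"
        then have "q \<in> heis_star" "koranyi_map q = koranyi_map p" by (auto simp: koranyi_fibre_def p)
        then show "F q \<in> koranyi_fibre (koranyi_map (F p))"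
          using F(1) Fk[of q p] by (simp add: koranyi_fibre_def)
      qed
      \<comment> \<open>The reverse inclusion: \<open>Gk\<close> places \<open>G q\<close> in the
        fibre through \<open>G (F p) = p\<close>.\<close>
      moreover have "q \<in> F ` koranyi_fibre \<zeta>" if "q \<in> koranyi_fibre (koranyi_map (F p))" for q
      proof
        have q: "q \<in> heis_star" "koranyi_map q = koranyi_map (F p)"
          using that by (auto simp: koranyi_fibre_def)
        show "q = F (G q)" using G q by simp
        show "G q \<in> koranyi_fibre \<zeta>"
          using Gk[OF q] G(1) F(2) p q by (simp add: koranyi_fibre_def)
      qed
      ultimately show "\<exists>\<eta>\<in>left_half_plane. F ` koranyi_fibre \<zeta> = koranyi_fibre \<eta>"
        using koranyi_map_in_left_half_plane F(1) p by blast
    qed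
  next
    assume "circles_preserving F"
    then have "\<exists>\<eta>. F ` koranyi_fibre \<zeta> \<subseteq> koranyi_fibre \<eta>" if "\<zeta> \<in> left_half_plane" for \<zeta>
      using that unfolding circles_preserving_def by blast
    then show "lam constant_on heis_star" by (rule F.fibres_imp_const_factor)
  qed
qed

end
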